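(* Let $p$ be a prime and $N=2m_1\cdots m_r$ where $p_1,\dots,p_r$ are distinct odd primes, $u_i\ge1$, $m_i=p_i^{u_i}$, and suppose $f=\mathrm{ord}_N(p)$ is odd. If there exists an integer $i$ with $p^i\equiv 2\pmod{N/2}$, then $(N,f,p)\in\mathcal{P}^\ast$ and $(N,f,p)$ has property $(\star)$.
   Context: For $n\mid p^f-1$ and $\eta_n$ a multiplicative character of order $n$ of $\mathbb{F}_{p^f}$, $G_{p^f}(\eta_n)=\sum_{x\in\mathbb{F}_{p^f}^\ast}\zeta_p^{\mathrm{Tr}_{p^f/p}(x)}\eta_n(x)$ with $\zeta_k=\exp(2\pi i/k)$; it is pure if $p^{-f/2}G_{p^f}(\eta_n)$ is a root of unity (independent of the choice of $\eta_n$). $\mathcal{P}$ is the set of triples $(n,f,p)$, $n\mid p^f-1$, for which it is pure; $\mathcal{P}^\ast=\{(n,f,p)\in\mathcal{P}:\mathrm{ord}_n(p)=f\}$. Property $(\star)$: $(2\prod_{i\in J}m_i,f,p)\in\mathcal{P}$ for every $J\subseteq\{1,\dots,r\}$ with $1\in J$. *)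

theory Defs
  imports Complex_Main "HOL-Algebra.Multiplicative_Group" "HOL-Number_Theory.Number_Theory"
begin

definition complex_mult :: "complex monoid" where
  "complex_mult = \<lparr>carrier = - {0}, monoid.mult = (*), one = 1\<rparr>"

definition mult_char :: "('a, 'b) ring_scheme \<Rightarrow> ('a \<Rightarrow> complex) \<Rightarrow> bool" where
  "mult_char R \<eta> \<longleftrightarrow> \<eta> \<in> hom (mult_of R) complex_mult"

definition char_order :: "('a, 'b) ring_scheme \<Rightarrow> ('a \<Rightarrow> complex) \<Rightarrow> nat" where
  "char_order R \<eta> = (LEAST k. 0 < k \<and> (\<forall>x\<in>carrier (mult_of R). \<eta> x ^ k = 1))"

definition abs_trace :: "('a, 'b) ring_scheme \<Rightarrow> nat \<Rightarrow> nat \<Rightarrow> 'a \<Rightarrow> 'a" where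
  "abs_trace R p f x = (\<Oplus>\<^bsub>R\<^esub>j\<in>{..<f}. x [^]\<^bsub>R\<^esub> (p ^ j))"

text \<open>The trace lies in the prime field; it is identified with the residue \<open>t < p\<close>
  such that it equals \<open>t\<close> times the unit element, so that it can be used as an exponent of
  a \<open>p\<close>-th root of unity.\<close>

definition trace_residue :: "('a, 'b) ring_scheme \<Rightarrow> nat \<Rightarrow> nat \<Rightarrow> 'a \<Rightarrow> nat" where
  "trace_residue R p f x = (THE t. t < p \<and> [t] \<cdot>\<^bsub>R\<^esub> \<one>\<^bsub>R\<^esub> = abs_trace R p f x)"

definition zeta :: "nat \<Rightarrow> complex" where
  "zeta k = exp (2 * of_real pi * \<i> / of_nat k)"

definition Gauss_sum :: "('a, 'b) ring_scheme \<Rightarrow> nat \<Rightarrow> nat \<Rightarrow> ('a \<Rightarrow> complex) \<Rightarrow> complex" where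
  "Gauss_sum R p f \<eta> = (\<Sum>x\<in>carrier (mult_of R). zeta p ^ trace_residue R p f x * \<eta> x)"

definition root_of_unity :: "complex \<Rightarrow> bool" where
  "root_of_unity z \<longleftrightarrow> (\<exists>k::nat. 0 < k \<and> z ^ k = 1)"

definition pure_Gauss_sum :: "('a, 'b) ring_scheme \<Rightarrow> nat \<Rightarrow> nat \<Rightarrow> ('a \<Rightarrow> complex) \<Rightarrow> bool" where
  "pure_Gauss_sum R p f \<eta> \<longleftrightarrow>
     root_of_unity (of_real (real p powr (- real f / 2)) * Gauss_sum R p f \<eta>)"

text \<open>A field with \<open>p ^ f\<close> elements exists, is unique up to isomorphism and has an isomorphic
  copy with carrier a set of natural numbers; if \<open>n\<close> divides \<open>p ^ f - 1\<close>, it has a character of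
  order \<open>n\<close>. Purity depends neither on the copy nor on the character, so the universal
  quantifiers below range over nonempty collections and any member of them decides the matter.\<close>

definition pure_triples :: "(nat \<times> nat \<times> nat) set" where
  "pure_triples = {(n, f, p). prime p \<and> 0 < f \<and> n dvd p ^ f - 1 \<and>
     (\<forall>(F :: nat ring) \<eta>. field F \<and> finite (carrier F) \<and> card (carrier F) = p ^ f \<and>
        mult_char F \<eta> \<and> char_order F \<eta> = n \<longrightarrow> pure_Gauss_sum F p f \<eta>)}"

definition pure_triples_star :: "(nat \<times> nat \<times> nat) set" where
  "pure_triples_star = {(n, f, p) \<in> pure_triples. ord n p = f}"

definition property_star :: "(nat \<Rightarrow> nat) \<Rightarrow> nat \<Rightarrow> nat \<Rightarrow> nat \<Rightarrow> bool" where
  "property_star m r f p \<longleftrightarrow>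
     (\<forall>J. J \<subseteq> {1..r} \<and> 1 \<in> J \<longrightarrow> (2 * (\<Prod>i\<in>J. m i), f, p) \<in> pure_triples)"

text \<open>Powers modulo \<open>m\<close> with a possibly negative exponent, for \<open>a\<close> coprime to \<open>m\<close>.\<close>

definition mod_powi :: "int \<Rightarrow> int \<Rightarrow> int \<Rightarrow> int" where
  "mod_powi m a i = (if 0 \<le> i then a ^ nat i else modular_inverse m a ^ nat (- i))"

end

theory Submission
  imports Defs
begin

text \<open>
  Put \<open>M = N / 2\<close>, which is odd. A character \<open>\<theta>\<close> of order \<open>2 M\<close> factors as \<open>\<theta> = \<eta> \<chi>\<close> with \<open>\<eta> = \<theta> ^ M\<close>
  quadratic and \<open>\<chi> = \<theta> ^ (M + 1)\<close> of order \<open>M\<close>. The duplication case of the Davenport--Hasse product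
  formula reads \<open>\<chi>(4) G(\<chi>) G(\<eta> \<chi>) = G(\<chi>\<^sup>2) G(\<eta>)\<close>. Since \<open>2\<close> is congruent to a power of \<open>p\<close> modulo \<open>M\<close>,
  \<open>\<chi>\<^sup>2\<close> is a Frobenius conjugate of \<open>\<chi>\<close>, so \<open>G(\<chi>\<^sup>2) = G(\<chi>) \<noteq> 0\<close>. Hence \<open>\<chi>(4) G(\<theta>) = G(\<eta>)\<close>, and
  \<open>G(\<eta>)\<^sup>2 = \<plusminus> p ^ f\<close>. The argument only uses that \<open>2 M\<close> divides \<open>p ^ f - 1\<close>, so it applies to every
  divisor \<open>2 M'\<close> of \<open>N\<close> at once.
\<close>

section \<open>Gauss and Jacobi sums over a finite field\<close>

text \<open>Multiplicative characters take the value \<open>0\<close> at \<open>\<zero>\<close>, the trivial one included, so that all sums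
  run over the whole field.\<close>

definition (in ring) ext_char :: "('a \<Rightarrow> complex) \<Rightarrow> bool" where
  "ext_char \<chi> \<longleftrightarrow> \<chi> \<zero> = 0 \<and> \<chi> \<one> = 1 \<and>
     (\<forall>x\<in>carrier R. \<forall>y\<in>carrier R. \<chi> (x \<otimes> y) = \<chi> x * \<chi> y)"

text \<open>The additive character stays abstract here. The one built from the trace is supplied
  later by a sublocale declaration.\<close>

locale finite_field_additive_char = field R for R (structure) +
  fixes \<psi> :: "'a \<Rightarrow> complex"
  assumes finite_carrier: "finite (carrier R)"
    and psi_add: "\<lbrakk>x \<in> carrier R; y \<in> carrier R\<rbrakk> \<Longrightarrow> \<psi> (x \<oplus> y) = \<psi> x * \<psi> y"
    and psi_zero: "\<psi> \<zero> = 1"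
    and psi_nontrivial: "\<exists>a\<in>carrier R. \<psi> a \<noteq> 1"
begin

definition gauss :: "('a \<Rightarrow> complex) \<Rightarrow> complex" where
  "gauss \<chi> = (\<Sum>x\<in>carrier R. \<chi> x * \<psi> x)"

text \<open>For characters in the sense of \<open>ext_char\<close> the terms at
  \<open>\<zero>\<close> and \<open>\<one>\<close> vanish, also when a character is trivial.\<close>

definition jacobi :: "('a \<Rightarrow> complex) \<Rightarrow> ('a \<Rightarrow> complex) \<Rightarrow> complex" where
  "jacobi \<chi> \<chi>' = (\<Sum>u\<in>carrier R. \<chi> u * \<chi>' (\<one> \<ominus> u))"

lemma ext_charD:
  assumes "ext_char \<chi>"
  shows "\<chi> \<zero> = 0" "\<chi> \<one> = 1"
    "\<And>x y. x \<in> carrier R \<Longrightarrow> y \<in> carrier R \<Longrightarrow> \<chi> (x \<otimes> y) = \<chi> x * \<chi> y"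
  using assms by (auto simp: ext_char_def)

lemma ext_char_mult: "ext_char \<chi> \<Longrightarrow> ext_char \<chi>' \<Longrightarrow> ext_char (\<lambda>x. \<chi> x * \<chi>' x)"
  by (simp add: ext_char_def)

lemma ext_char_power: "ext_char \<chi> \<Longrightarrow> 0 < n \<Longrightarrow> ext_char (\<lambda>x. \<chi> x ^ n)"
  by (simp add: ext_char_def power_mult_distrib)

lemma ext_char_inverse: "ext_char \<chi> \<Longrightarrow> ext_char (\<lambda>x. inverse (\<chi> x))"
  by (simp add: ext_char_def)

lemma ext_char_nonzero:
  assumes "ext_char \<chi>" "x \<in> carrier R" "x \<noteq> \<zero>"
  shows "\<chi> x \<noteq> 0"
proof
  assume "\<chi> x = 0"
  have x: "x \<in> Units R" using assms field_Units by auto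
  have "\<chi> (x \<otimes> inv x) = 0"
    using assms x \<open>\<chi> x = 0\<close> ext_charD(3)[of \<chi> x "inv x"] by simp
  with assms x show False by (simp add: ext_charD)
qed

lemma ext_char_minus_one_square:
  assumes "ext_char \<chi>" shows "\<chi> (\<ominus> \<one>) * \<chi> (\<ominus> \<one>) = 1"
proof -
  have "\<ominus> \<one> \<otimes> \<ominus> \<one> = \<one>" by algebra
  then show ?thesis using ext_charD[OF assms] by (metis a_inv_closed one_closed)
qed

section \<open>Substitutions in sums over the field, and vanishing character sums\<close>

lemma bij_betw_mult:
  assumes "a \<in> carrier R" "a \<noteq> \<zero>"
  shows "bij_betw (\<lambda>x. a \<otimes> x) (carrier R) (carrier R)"
proof -
  have "inj_on (\<lambda>x. a \<otimes> x) (carrier R)"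
    using assms by (auto simp: inj_on_def m_lcancel)
  moreover have "(\<lambda>x. a \<otimes> x) ` carrier R \<subseteq> carrier R" using assms by auto
  ultimately show ?thesis
    using endo_inj_surj[OF finite_carrier] by (auto simp: bij_betw_def)
qed

lemma bij_betw_add:
  assumes "a \<in> carrier R"
  shows "bij_betw (\<lambda>x. a \<oplus> x) (carrier R) (carrier R)"
proof -
  have "inj_on (\<lambda>x. a \<oplus> x) (carrier R)"
    using assms by (auto simp: inj_on_def)
  moreover have "(\<lambda>x. a \<oplus> x) ` carrier R \<subseteq> carrier R" using assms by auto
  ultimately show ?thesis
    using endo_inj_surj[OF finite_carrier] by (auto simp: bij_betw_def)
qed

lemma bij_betw_diff:
  assumes "a \<in> carrier R"
  shows "bij_betw (\<lambda>x. a \<ominus> x) (carrier R) (carrier R)"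
proof (rule bij_betw_byWitness[where f' = "\<lambda>x. a \<ominus> x"])
  have "a \<ominus> (a \<ominus> x) = x" if "x \<in> carrier R" for x
    using assms that by algebra
  then show "\<forall>x\<in>carrier R. a \<ominus> (a \<ominus> x) = x" "\<forall>x\<in>carrier R. a \<ominus> (a \<ominus> x) = x" by auto
qed (use assms in auto)

text \<open>The substitution of \<open>a \<otimes> x\<close> for \<open>x\<close> multiplies the sum
  by \<open>\<chi> a\<close>, which differs from 1.\<close>

lemma sum_ext_char_eq_0:
  assumes "ext_char \<chi>" "a \<in> carrier R" "a \<noteq> \<zero>" "\<chi> a \<noteq> 1"
  shows "(\<Sum>x\<in>carrier R. \<chi> x) = 0"
proof -
  have "(\<Sum>x\<in>carrier R. \<chi> x) = (\<Sum>x\<in>carrier R. \<chi> (a \<otimes> x))"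
    using sum.reindex_bij_betw[OF bij_betw_mult[OF assms(2,3)], of \<chi>] by simp
  also have "\<dots> = \<chi> a * (\<Sum>x\<in>carrier R. \<chi> x)"
    using assms by (simp add: ext_charD sum_distrib_left)
  finally show ?thesis using assms(4) by simp
qed

lemma sum_psi_eq_0: "(\<Sum>x\<in>carrier R. \<psi> x) = 0"
proof -
  obtain a where a: "a \<in> carrier R" "\<psi> a \<noteq> 1" using psi_nontrivial by auto
  have "(\<Sum>x\<in>carrier R. \<psi> x) = (\<Sum>x\<in>carrier R. \<psi> (a \<oplus> x))"
    using sum.reindex_bij_betw[OF bij_betw_add[OF a(1)], of \<psi>] by simp
  also have "\<dots> = \<psi> a * (\<Sum>x\<in>carrier R. \<psi> x)"
    using a by (simp add: psi_add sum_distrib_left)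
  finally show ?thesis using a(2) by simp
qed

text \<open>The pairs of summands are grouped by the sum \<open>s\<close> of their two arguments.
  With \<open>\<psi>\<close> included this computes products of Gauss sums; without it, it evaluates
  a Jacobi sum.\<close>

lemma sum_mult_convolution:
  fixes g h :: "'a \<Rightarrow> complex"
  shows "(\<Sum>x\<in>carrier R. g x) * (\<Sum>y\<in>carrier R. h y) =
    (\<Sum>s\<in>carrier R. \<Sum>x\<in>carrier R. g x * h (s \<ominus> x))"
proof -
  have *: "(\<Sum>s\<in>carrier R. h (s \<ominus> x)) = (\<Sum>y\<in>carrier R. h y)" if x: "x \<in> carrier R" for x
    using sum.reindex_bij_betw[OF bij_betw_add[of "\<ominus> x"], of h] x
    by (simp add: a_minus_def a_comm cong: sum.cong)
  have "(\<Sum>s\<in>carrier R. \<Sum>x\<in>carrier R. g x * h (s \<ominus> x)) =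
    (\<Sum>x\<in>carrier R. \<Sum>s\<in>carrier R. g x * h (s \<ominus> x))"
    by (rule sum.swap)
  also have "\<dots> = (\<Sum>x\<in>carrier R. g x * (\<Sum>y\<in>carrier R. h y))"
    by (simp add: * flip: sum_distrib_left)
  finally show ?thesis by (simp add: sum_distrib_right)
qed

text \<open>The substitution of \<open>s \<otimes> u\<close> for \<open>x\<close> makes both factors
  homogeneous in \<open>s\<close>.\<close>

lemma convolution_ext_char:
  assumes "ext_char \<chi>" "ext_char \<chi>'" "s \<in> carrier R" "s \<noteq> \<zero>"
  shows "(\<Sum>x\<in>carrier R. \<chi> x * \<chi>' (s \<ominus> x)) = \<chi> s * \<chi>' s * jacobi \<chi> \<chi>'"
proof -
  have "(\<Sum>x\<in>carrier R. \<chi> x * \<chi>' (s \<ominus> x)) =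
    (\<Sum>u\<in>carrier R. \<chi> (s \<otimes> u) * \<chi>' (s \<ominus> s \<otimes> u))"
    using sum.reindex_bij_betw[OF bij_betw_mult[OF assms(3,4)], of "\<lambda>x. \<chi> x * \<chi>' (s \<ominus> x)"] by simp
  also have "\<dots> = (\<Sum>u\<in>carrier R. \<chi> s * \<chi>' s * (\<chi> u * \<chi>' (\<one> \<ominus> u)))"
  proof (rule sum.cong[OF refl])
    fix u assume u: "u \<in> carrier R"
    have "s \<ominus> s \<otimes> u = s \<otimes> (\<one> \<ominus> u)" using u assms(3) by algebra
    then show "\<chi> (s \<otimes> u) * \<chi>' (s \<ominus> s \<otimes> u) = \<chi> s * \<chi>' s * (\<chi> u * \<chi>' (\<one> \<ominus> u))"
      using u assms by (simp add: ext_charD)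
  qed
  finally show ?thesis by (simp add: jacobi_def sum_distrib_left)
qed

lemma convolution_ext_char_zero:
  assumes "ext_char \<chi>'"
  shows "(\<Sum>x\<in>carrier R. \<chi> x * \<chi>' (\<zero> \<ominus> x)) = \<chi>' (\<ominus> \<one>) * (\<Sum>x\<in>carrier R. \<chi> x * \<chi>' x)"
proof -
  have "\<chi>' (\<zero> \<ominus> x) = \<chi>' (\<ominus> \<one>) * \<chi>' x" if x: "x \<in> carrier R" for x
  proof -
    have "\<zero> \<ominus> x = \<ominus> \<one> \<otimes> x" using x by algebra
    then show ?thesis using x assms by (simp add: ext_charD(3) del: l_minus)
  qed
  then show ?thesis by (simp add: sum_distrib_left mult_ac cong: sum.cong)
qed

section \<open>Products of two Gauss sums\<close>

lemma gauss_mult_eq_sum: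
  "gauss \<chi> * gauss \<chi>' = (\<Sum>s\<in>carrier R. \<psi> s * (\<Sum>x\<in>carrier R. \<chi> x * \<chi>' (s \<ominus> x)))"
proof -
  have "\<psi> x * \<psi> (s \<ominus> x) = \<psi> s" if "s \<in> carrier R" "x \<in> carrier R" for s x
  proof -
    have "x \<oplus> (s \<ominus> x) = s" using that by algebra
    then show ?thesis using psi_add[of x "s \<ominus> x"] that by simp
  qed
  then have "\<chi> x * \<psi> x * (\<chi>' (s \<ominus> x) * \<psi> (s \<ominus> x)) = \<psi> s * (\<chi> x * \<chi>' (s \<ominus> x))"
    if "s \<in> carrier R" "x \<in> carrier R" for s x
    using that by (metis (no_types, lifting) mult.assoc mult.commute)
  then show ?thesis
    unfolding gauss_def sum_mult_convolution 
    by (simp only: sum_distrib_left cong: sum.cong)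
qed

text \<open>Each nonzero \<open>s\<close> contributes a multiple of the Jacobi sum. The contribution
  of \<open>s = \<zero>\<close> is a multiple of the sum of \<open>\<chi> x * \<chi>' x\<close>,
  which is assumed to vanish.\<close>

lemma gauss_mult:
  assumes "ext_char \<chi>" "ext_char \<chi>'"
    and "(\<Sum>x\<in>carrier R. \<chi> x * \<chi>' x) = 0"
  shows "gauss \<chi> * gauss \<chi>' = jacobi \<chi> \<chi>' * gauss (\<lambda>x. \<chi> x * \<chi>' x)"
proof -
  have "\<psi> s * (\<Sum>x\<in>carrier R. \<chi> x * \<chi>' (s \<ominus> x)) = jacobi \<chi> \<chi>' * (\<chi> s * \<chi>' s * \<psi> s)"
    if "s \<in> carrier R" for s
    using that assms
    by (cases "s = \<zero>") (simp_all add: convolution_ext_char convolution_ext_char_zero ext_charD)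
  then show ?thesis
    unfolding gauss_mult_eq_sum by (simp add: gauss_def sum_distrib_left cong: sum.cong)
qed

lemma sum_carrier_remove_zero:
  "(\<Sum>x\<in>carrier R. h x) = h \<zero> + (\<Sum>x\<in>carrier R - {\<zero>}. h x)" for h :: "'a \<Rightarrow> complex"
  using finite_carrier by (simp add: sum.remove)

text \<open>This plays the role of the absolute value formula for Gauss sums. The Jacobi sum of
  \<open>\<chi>\<close> and its inverse equals \<open>- \<chi> (\<ominus> \<one>)\<close>, and the
  product of the Gauss sums is then read off from its expansion over \<open>s\<close>.\<close>

lemma gauss_mult_inverse:
  assumes \<chi>: "ext_char \<chi>" and "a \<in> carrier R" "a \<noteq> \<zero>" "\<chi> a \<noteq> 1"
  shows "gauss \<chi> * gauss (\<lambda>x. inverse (\<chi> x)) = \<chi> (\<ominus> \<one>) * of_nat (card (carrier R))"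
proof -
  define \<chi>' where "\<chi>' = (\<lambda>x. inverse (\<chi> x))"
  have \<chi>': "ext_char \<chi>'" unfolding \<chi>'_def using \<chi> by (rule ext_char_inverse)
  define q :: complex where "q = of_nat (card (carrier R))"
  define S where "S s = (\<Sum>x\<in>carrier R. \<chi> x * \<chi>' (s \<ominus> x))" for s
  have card: "of_nat (card (carrier R - {\<zero>})) = q - 1"
    using finite_carrier card_gt_0_iff[of "carrier R"] unfolding q_def
    by (auto simp: card_Diff_singleton of_nat_diff Suc_leI)
  have inv: "\<chi> x * \<chi>' x = 1" if "x \<in> carrier R - {\<zero>}" for x
    using that \<chi> by (simp add: \<chi>'_def ext_char_nonzero)
  have m1: "\<chi>' (\<ominus> \<one>) = \<chi> (\<ominus> \<one>)"
    unfolding \<chi>'_def by (rule inverse_unique) (rule ext_char_minus_one_square[OF \<chi>])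
  have "(\<Sum>x\<in>carrier R - {\<zero>}. \<chi> x * \<chi>' x) = (\<Sum>x\<in>carrier R - {\<zero>}. 1)"
    by (rule sum.cong[OF refl inv])
  then have sum_inv: "(\<Sum>x\<in>carrier R - {\<zero>}. \<chi> x * \<chi>' x) = q - 1"
    by (simp only: card[symmetric]) simp
  have S0: "S \<zero> = \<chi> (\<ominus> \<one>) * (q - 1)"
    unfolding S_def convolution_ext_char_zero[OF \<chi>'] sum_carrier_remove_zero[of "\<lambda>x. \<chi> x * \<chi>' x"]
    using \<chi> by (simp add: sum_inv m1 ext_charD)
  have S1: "S s = jacobi \<chi> \<chi>'" if "s \<in> carrier R - {\<zero>}" for s
    unfolding S_def using that \<chi> \<chi>' inv by (simp add: convolution_ext_char)
  \<comment> \<open>Without the weights \<open>\<psi> s\<close> the convolution factors as a product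
    of two plain character sums, the first of which is 0. This is a linear equation for the Jacobi
    sum.\<close>
  have "0 = (\<Sum>s\<in>carrier R. S s)"
    unfolding S_def sum_mult_convolution[symmetric] using sum_ext_char_eq_0[OF assms] by simp
  also have "\<dots> = (q - 1) * (\<chi> (\<ominus> \<one>) + jacobi \<chi> \<chi>')"
    unfolding sum_carrier_remove_zero[of S]
    by (simp only: S0 S1 sum_constant card cong: sum.cong) (simp add: algebra_simps)
  finally have "q - 1 = 0 \<or> \<chi> (\<ominus> \<one>) + jacobi \<chi> \<chi>' = 0" by simp
  moreover have "q - 1 \<noteq> 0"
  proof -
    have "card {\<zero>, \<one>} \<le> card (carrier R)" using finite_carrier by (intro card_mono) auto
    then show ?thesis by (simp add: q_def)
  qed
  ultimately have J: "jacobi \<chi> \<chi>' = - \<chi> (\<ominus> \<one>)" by (simp add: add_eq_0_iff)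
  have "gauss \<chi> * gauss \<chi>' = (\<Sum>s\<in>carrier R. \<psi> s * S s)"
    unfolding gauss_mult_eq_sum S_def ..
  also have "\<dots> = S \<zero> + (\<Sum>s\<in>carrier R - {\<zero>}. \<psi> s) * jacobi \<chi> \<chi>'"
    unfolding sum_carrier_remove_zero[of "\<lambda>s. \<psi> s * S s"] sum_distrib_right
    using S1 by (simp add: psi_zero)
  also have "(\<Sum>s\<in>carrier R - {\<zero>}. \<psi> s) = -1"
    using sum_psi_eq_0 sum_carrier_remove_zero[of \<psi>] by (simp add: psi_zero add_eq_0_iff)
  finally show ?thesis unfolding \<chi>'_def[symmetric] q_def[symmetric] J S0
    by (simp add: algebra_simps)
qed

lemma gauss_nonzero:
  assumes "ext_char \<chi>" "a \<in> carrier R" "a \<noteq> \<zero>" "\<chi> a \<noteq> 1"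
  shows "gauss \<chi> \<noteq> 0"
proof
  assume "gauss \<chi> = 0"
  then have "\<chi> (\<ominus> \<one>) * of_nat (card (carrier R)) = 0"
    using gauss_mult_inverse[OF assms] by simp
  then show False
    using ext_char_minus_one_square[OF assms(1)] finite_carrier by auto
qed

section \<open>Quadratic characters and the duplication formula\<close>

text \<open>A nonzero square has exactly the two roots \<open>b\<close> and
  \<open>\<ominus> b\<close>, distinct because \<open>\<one> \<oplus> \<one>\<close> is nonzero. A
  nonsquare is an odd power of a generator of the multiplicative group, on which
  \<open>\<eta>\<close> is -1.\<close>

lemma card_square_roots:
  assumes two: "\<one> \<oplus> \<one> \<noteq> \<zero>" and \<eta>: "ext_char \<eta>"
    and quad: "\<And>x. x \<in> carrier R \<Longrightarrow> x \<noteq> \<zero> \<Longrightarrow> \<eta> x ^ 2 = 1"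
    and a: "a \<in> carrier R" "a \<noteq> \<zero>" "\<eta> a \<noteq> 1"
    and v: "v \<in> carrier R"
  shows "of_nat (card {w \<in> carrier R. w \<otimes> w = v}) = 1 + \<eta> v"
proof (cases "v = \<zero>")
  case True
  then have "{w \<in> carrier R. w \<otimes> w = v} = {\<zero>}" by (auto simp: integral_iff)
  then show ?thesis using True \<eta> by (simp add: ext_charD)
next
  case False
  show ?thesis
  proof (cases "\<exists>b\<in>carrier R. b \<otimes> b = v")
    case True
    then obtain b where b: "b \<in> carrier R" "b \<otimes> b = v" by auto
    have b0: "b \<noteq> \<zero>" using b False by auto
    have "w = b \<or> w = \<ominus> b" if w: "w \<in> carrier R" "w \<otimes> w = b \<otimes> b" for w
    proof -
      have "(w \<ominus> b) \<otimes> (w \<oplus> b) = w \<otimes> w \<ominus> b \<otimes> b" using w(1) b(1) by algebra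
      then have "(w \<ominus> b) \<otimes> (w \<oplus> b) = \<zero>" using w b(1) by simp
      then have "w \<ominus> b = \<zero> \<or> w \<oplus> b = \<zero>" using w(1) b(1) by (subst (asm) integral_iff) simp_all
      then show ?thesis using w(1) b(1) r_right_minus_eq[of w b] sum_zero_eq_neg[of w b] by blast
    qed
    moreover have "\<ominus> b \<otimes> \<ominus> b = b \<otimes> b" using b(1) by algebra
    ultimately have "{w \<in> carrier R. w \<otimes> w = v} = {b, \<ominus> b}" using b by auto
    moreover have "b \<noteq> \<ominus> b"
    proof
      assume "b = \<ominus> b"
      then have "b \<oplus> b = \<zero>" using b(1) r_neg by metis
      moreover have "b \<oplus> b = (\<one> \<oplus> \<one>) \<otimes> b" using b(1) by algebra
      ultimately show False using integral[of "\<one> \<oplus> \<one>" b] b(1) b0 two by auto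
    qed
    moreover have "\<eta> v = 1"
      using b b0 quad[of b] \<eta> by (auto simp: ext_charD power2_eq_square)
    ultimately show ?thesis by simp
  next
    case nosq: False
    obtain g where g: "g \<in> carrier (mult_of R)" "carrier (mult_of R) = {g [^] i |i::nat. i \<in> UNIV}"
      using finite_field_mult_group_has_gen[OF finite_carrier] by auto
    have pow: "\<eta> (g [^] i) = \<eta> g ^ i" for i :: nat
      using g \<eta> by (induction i) (auto simp: ext_charD)
    obtain i :: nat where i: "a = g [^] i" using g a by auto
    obtain j :: nat where j: "v = g [^] j" using g v False by auto
    \<comment> \<open>Otherwise \<open>\<eta>\<close> would be 1 on every power of \<open>g\<close>,
      in particular at \<open>a\<close>.\<close>
    have "\<eta> g \<noteq> 1" using a(3) i pow by auto
    moreover have "\<eta> g ^ 2 = 1" using g quad by auto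
    ultimately have \<eta>g: "\<eta> g = -1" by (simp add: power2_eq_1_iff)
    have "odd j"
    proof
      assume "even j"
      then obtain k where "j = k + k" by (metis evenE mult_2)
      then have "g [^] k \<otimes> g [^] k = v" using j g by (simp add: nat_pow_mult)
      then show False using nosq g by auto
    qed
    then have "\<eta> v = -1" using j pow \<eta>g by simp
    moreover have "card {w \<in> carrier R. w \<otimes> w = v} = 0" using nosq by (auto simp: card_eq_0_iff)
    ultimately show ?thesis by simp
  qed
qed

lemma sum_squares:
  fixes h :: "'a \<Rightarrow> complex"
  assumes two: "\<one> \<oplus> \<one> \<noteq> \<zero>" and \<eta>: "ext_char \<eta>"
    and quad: "\<And>x. x \<in> carrier R \<Longrightarrow> x \<noteq> \<zero> \<Longrightarrow> \<eta> x ^ 2 = 1"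
    and a: "a \<in> carrier R" "a \<noteq> \<zero>" "\<eta> a \<noteq> 1"
  shows "(\<Sum>w\<in>carrier R. h (w \<otimes> w)) = (\<Sum>v\<in>carrier R. h v * (1 + \<eta> v))"
proof -
  have "(\<Sum>w\<in>carrier R. h (w \<otimes> w)) =
    (\<Sum>v\<in>carrier R. \<Sum>w\<in>{w \<in> carrier R. w \<otimes> w = v}. h (w \<otimes> w))"
    using finite_carrier by (intro sum.group[symmetric]) auto
  also have "\<dots> = (\<Sum>v\<in>carrier R. h v * (1 + \<eta> v))"
    using card_square_roots[OF assms] by (intro sum.cong) (auto simp: mult.commute)
  finally show ?thesis .
qed

text \<open>With \<open>w = \<one> \<ominus> (\<one> \<oplus> \<one>) \<otimes> u\<close>, four
  times \<open>u \<otimes> (\<one> \<ominus> u)\<close> becomes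
  \<open>\<one> \<ominus> w \<otimes> w\<close>. Counting square roots by
  \<open>1 + \<eta> v\<close> then leaves a plain sum of \<open>\<chi>\<close>, which vanishes, and
  the mixed Jacobi sum.\<close>

lemma jacobi_self:
  assumes two: "\<one> \<oplus> \<one> \<noteq> \<zero>" and \<eta>: "ext_char \<eta>"
    and quad: "\<And>x. x \<in> carrier R \<Longrightarrow> x \<noteq> \<zero> \<Longrightarrow> \<eta> x ^ 2 = 1"
    and a: "a \<in> carrier R" "a \<noteq> \<zero>" "\<eta> a \<noteq> 1"
    and \<chi>: "ext_char \<chi>" and b: "b \<in> carrier R" "b \<noteq> \<zero>" "\<chi> b \<noteq> 1"
  shows "\<chi> (\<one> \<oplus> \<one>) ^ 2 * jacobi \<chi> \<chi> = jacobi \<eta> \<chi>"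
proof -
  let ?t = "\<one> \<oplus> \<one>"
  have bij: "bij_betw (\<lambda>u. \<one> \<ominus> ?t \<otimes> u) (carrier R) (carrier R)"
    using bij_betw_trans[OF bij_betw_mult[of ?t] bij_betw_diff[of \<one>]] two by (simp add: o_def)
  have "\<chi> ?t ^ 2 * jacobi \<chi> \<chi> = (\<Sum>u\<in>carrier R. \<chi> (\<one> \<ominus> (\<one> \<ominus> ?t \<otimes> u) \<otimes> (\<one> \<ominus> ?t \<otimes> u)))"
    unfolding jacobi_def sum_distrib_left
  proof (rule sum.cong[OF refl])
    fix u assume u: "u \<in> carrier R"
    have "\<one> \<ominus> (\<one> \<ominus> ?t \<otimes> u) \<otimes> (\<one> \<ominus> ?t \<otimes> u) = (?t \<otimes> ?t) \<otimes> (u \<otimes> (\<one> \<ominus> u))"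
    proof -
      \<comment> \<open>The ring identity is split in two: first \<open>a\<close> stands for
        \<open>?t \<otimes> u\<close>, then an arbitrary \<open>c\<close> stands for
        \<open>?t\<close>.\<close>
      have "\<one> \<ominus> (\<one> \<ominus> a) \<otimes> (\<one> \<ominus> a) = a \<otimes> (?t \<ominus> a)" if "a \<in> carrier R" for a
        using that by algebra
      then have "\<one> \<ominus> (\<one> \<ominus> ?t \<otimes> u) \<otimes> (\<one> \<ominus> ?t \<otimes> u) = ?t \<otimes> u \<otimes> (?t \<ominus> ?t \<otimes> u)"
        using u by simp
      moreover have "c \<otimes> u \<otimes> (c \<ominus> c \<otimes> u) = (c \<otimes> c) \<otimes> (u \<otimes> (\<one> \<ominus> u))" if "c \<in> carrier R" for c
        using u that by algebra
      ultimately show ?thesis by simp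
    qed
    then show "\<chi> ?t ^ 2 * (\<chi> u * \<chi> (\<one> \<ominus> u)) = \<chi> (\<one> \<ominus> (\<one> \<ominus> ?t \<otimes> u) \<otimes> (\<one> \<ominus> ?t \<otimes> u))"
      using u \<chi> by (simp add: ext_charD(3) power2_eq_square)
  qed
  also have "\<dots> = (\<Sum>w\<in>carrier R. \<chi> (\<one> \<ominus> w \<otimes> w))"
    by (rule sum.reindex_bij_betw[OF bij])
  also have "\<dots> = (\<Sum>v\<in>carrier R. \<chi> (\<one> \<ominus> v) * (1 + \<eta> v))"
    by (rule sum_squares[OF assms(1-6), of "\<lambda>x. \<chi> (\<one> \<ominus> x)"])
  also have "\<dots> = (\<Sum>v\<in>carrier R. \<chi> (\<one> \<ominus> v)) + jacobi \<eta> \<chi>"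
    by (simp add: jacobi_def algebra_simps sum.distrib)
  also have "(\<Sum>v\<in>carrier R. \<chi> (\<one> \<ominus> v)) = (\<Sum>v\<in>carrier R. \<chi> v)"
    by (rule sum.reindex_bij_betw[OF bij_betw_diff]) simp
  also have "\<dots> = 0" by (rule sum_ext_char_eq_0[OF \<chi> b])
  finally show ?thesis by simp
qed

text \<open>The products \<open>gauss \<eta> * gauss \<chi>\<close> and
  \<open>gauss \<chi> * gauss \<chi>\<close> are expressed by Jacobi sums, and
  \<open>jacobi_self\<close> compares these.\<close>

theorem gauss_duplication:
  assumes two: "\<one> \<oplus> \<one> \<noteq> \<zero>" and \<eta>: "ext_char \<eta>"
    and quad: "\<And>x. x \<in> carrier R \<Longrightarrow> x \<noteq> \<zero> \<Longrightarrow> \<eta> x ^ 2 = 1"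
    and a: "a \<in> carrier R" "a \<noteq> \<zero>" "\<eta> a \<noteq> 1"
    and \<chi>: "ext_char \<chi>"
    and b: "b \<in> carrier R" "b \<noteq> \<zero>" "\<chi> b ^ 2 \<noteq> 1"
  shows "\<chi> (\<one> \<oplus> \<one>) ^ 2 * (gauss \<chi> * gauss (\<lambda>x. \<eta> x * \<chi> x)) = gauss (\<lambda>x. \<chi> x ^ 2) * gauss \<eta>"
proof -
  \<comment> \<open>The single element \<open>b\<close> witnesses that \<open>\<chi>\<close>, its
    square and \<open>\<eta> \<chi>\<close> are all nontrivial.\<close>
  have b1: "\<chi> b \<noteq> 1" using b(3) by auto
  have "\<eta> b * \<chi> b \<noteq> 1"
  proof
    assume "\<eta> b * \<chi> b = 1"
    then have "(\<eta> b * \<chi> b) ^ 2 = 1" by simp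
    with quad[OF b(1,2)] b(3) show False by (simp add: power_mult_distrib)
  qed
  then have "(\<Sum>x\<in>carrier R. \<eta> x * \<chi> x) = 0"
    using sum_ext_char_eq_0[OF ext_char_mult[OF \<eta> \<chi>] b(1,2)] by simp
  note eq1 = gauss_mult[OF \<eta> \<chi> this]
  have "(\<Sum>x\<in>carrier R. \<chi> x * \<chi> x) = 0"
    using sum_ext_char_eq_0[OF ext_char_mult[OF \<chi> \<chi>] b(1,2)] b(3) by (simp add: power2_eq_square)
  note eq2 = gauss_mult[OF \<chi> \<chi> this]
  have eq3: "\<chi> (\<one> \<oplus> \<one>) ^ 2 * jacobi \<chi> \<chi> = jacobi \<eta> \<chi>"
    by (rule jacobi_self[OF two \<eta> quad a \<chi> b(1,2) b1])
  \<comment> \<open>The claim is proved after multiplication by \<open>gauss \<chi>\<close>, which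
    creates the product \<open>gauss \<chi> * gauss \<chi>\<close>; the extra factor is cancelled at
    the end.\<close>
  have "gauss \<chi> \<noteq> 0" by (rule gauss_nonzero[OF \<chi> b(1,2) b1])
  moreover have "gauss \<chi> * (\<chi> (\<one> \<oplus> \<one>) ^ 2 * (gauss \<chi> * gauss (\<lambda>x. \<eta> x * \<chi> x))) =
    gauss \<chi> * (gauss (\<lambda>x. \<chi> x ^ 2) * gauss \<eta>)"
  proof -
    have "gauss \<chi> * (\<chi> (\<one> \<oplus> \<one>) ^ 2 * (gauss \<chi> * gauss (\<lambda>x. \<eta> x * \<chi> x))) =
      \<chi> (\<one> \<oplus> \<one>) ^ 2 * (gauss \<chi> * gauss \<chi>) * gauss (\<lambda>x. \<eta> x * \<chi> x)" by simp
    also have "\<dots> = (\<chi> (\<one> \<oplus> \<one>) ^ 2 * jacobi \<chi> \<chi>) * gauss (\<lambda>x. \<chi> x ^ 2) * gauss (\<lambda>x. \<eta> x * \<chi> x)"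
      unfolding eq2 by (simp add: power2_eq_square)
    also have "\<dots> = gauss (\<lambda>x. \<chi> x ^ 2) * (gauss \<eta> * gauss \<chi>)"
      unfolding eq3 eq1 by simp
    finally show ?thesis by simp
  qed
  ultimately show ?thesis by simp
qed

end

section \<open>The absolute trace\<close>

context cring
begin

lemma binomial_expansion:
  assumes x: "x \<in> carrier R" and y: "y \<in> carrier R"
  shows "(x \<oplus> y) [^] n = (\<Oplus>k\<in>{..n}. [(n choose k)] \<cdot> (x [^] k \<otimes> y [^] (n - k)))"
proof (induction n)
  case 0
  show ?case using x y by simp
next
  case (Suc n)
  let ?a = "\<lambda>k. [(n choose k)] \<cdot> (x [^] Suc k \<otimes> y [^] (n - k))"
  let ?b = "\<lambda>k. [(n choose k)] \<cdot> (x [^] k \<otimes> y [^] (Suc n - k))"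
  let ?c = "\<lambda>k. [(Suc n choose k)] \<cdot> (x [^] k \<otimes> y [^] (Suc n - k))"
  have c: "?c (Suc k) = ?a k \<oplus> ?b (Suc k)" for k
    using x y by (simp add: add.nat_pow_mult)
  have 1: "[(n choose k)] \<cdot> (x [^] k \<otimes> y [^] (n - k)) \<otimes> x = ?a k" for k
    using x y by (subst add_pow_ldistr) (simp_all add: m_ac)
  have 2: "[(n choose k)] \<cdot> (x [^] k \<otimes> y [^] (n - k)) \<otimes> y = ?b k" if "k \<le> n" for k
    using x y that by (subst add_pow_ldistr) (simp_all add: m_ac Suc_diff_le)
  have "(x \<oplus> y) [^] Suc n =
    (\<Oplus>k\<in>{..n}. [(n choose k)] \<cdot> (x [^] k \<otimes> y [^] (n - k))) \<otimes> x \<oplus>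
    (\<Oplus>k\<in>{..n}. [(n choose k)] \<cdot> (x [^] k \<otimes> y [^] (n - k))) \<otimes> y"
    using x y Suc by (simp add: r_distr)
  also have "\<dots> = (\<Oplus>k\<in>{..n}. ?a k) \<oplus> (\<Oplus>k\<in>{..n}. ?b k)"
    using x y 1 2 by (simp add: finsum_ldistr Pi_def cong: finsum_cong)
  \<comment> \<open>The added term vanishes, since \<open>n choose Suc n\<close> is 0. Splitting off
    \<open>k = 0\<close> afterwards aligns the two sums for Pascal's rule.\<close>
  also have "(\<Oplus>k\<in>{..n}. ?b k) = (\<Oplus>k\<in>{..Suc n}. ?b k)"
    using x y by (subst finsum_Suc) (auto simp: binomial_eq_0)
  also have "\<dots> = (\<Oplus>k\<in>{..n}. ?b (Suc k)) \<oplus> ?b 0"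
    using x y by (subst finsum_Suc2) auto
  also have "(\<Oplus>k\<in>{..n}. ?a k) \<oplus> ((\<Oplus>k\<in>{..n}. ?b (Suc k)) \<oplus> ?b 0) =
    (\<Oplus>k\<in>{..n}. ?a k \<oplus> ?b (Suc k)) \<oplus> ?b 0"
    using x y by (subst finsum_addf) (auto simp: a_assoc)
  also have "\<dots> = (\<Oplus>k\<in>{..n}. ?c (Suc k)) \<oplus> ?c 0"
    unfolding c by simp
  also have "\<dots> = (\<Oplus>k\<in>{..Suc n}. ?c k)"
    using x y by (subst finsum_Suc2) auto
  finally show ?case .
qed

text \<open>The prime \<open>p\<close> divides every binomial coefficient strictly between the two
  ends, so only the end terms survive.\<close>

lemma frobenius_add:
  fixes p :: nat
  assumes p: "prime p" and char: "[p] \<cdot> \<one> = \<zero>"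
    and x: "x \<in> carrier R" and y: "y \<in> carrier R"
  shows "(x \<oplus> y) [^] p = x [^] p \<oplus> y [^] p"
proof -
  let ?c = "\<lambda>k. [(p choose k)] \<cdot> (x [^] k \<otimes> y [^] (p - k))"
  have zero: "?c k = \<zero>" if "k \<in> {..p} - {0, p}" for k
  proof -
    have "p dvd p choose k" using p that by (intro dvd_choose_prime) auto
    then obtain m where m: "p choose k = p * m" by auto
    have z: "x [^] k \<otimes> y [^] (p - k) \<in> carrier R" (is "?z \<in> _") using x y by simp
    have "[p] \<cdot> ?z = [p] \<cdot> \<one> \<otimes> ?z" using z by (simp add: add_pow_ldistr)
    then have "[p] \<cdot> ?z = \<zero>" using char z by simp
    then show ?thesis unfolding m using add.nat_pow_pow[OF z, of m p] by simp
  qed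
  have "p > 0" using p by (simp add: prime_gt_0_nat)
  have "(x \<oplus> y) [^] p = (\<Oplus>k\<in>{..p}. ?c k)" by (rule binomial_expansion[OF x y])
  also have "\<dots> = (\<Oplus>k\<in>{0, p}. ?c k)"
    using x y zero by (intro add.finprod_mono_neutral_cong_right) auto
  also have "\<dots> = x [^] p \<oplus> y [^] p"
    using x y \<open>p > 0\<close> by (simp add: a_comm)
  finally show ?thesis .
qed

end

section \<open>Fields with \<open>p ^ f\<close> elements\<close>

locale prime_power_field = field R for R (structure) +
  fixes p f :: nat
  assumes finite_carrier: "finite (carrier R)"
    and card_carrier: "card (carrier R) = p ^ f"
    and prime_p: "prime p"
    and f_pos: "0 < f"
begin

lemma p_gt_1: "1 < p" using prime_p by (rule prime_gt_1_nat)

text \<open>By Lagrange's theorem for the additive group, \<open>p ^ f\<close> annihilates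
  \<open>\<one>\<close>. Hence the \<open>f\<close>-th power of \<open>[p] \<cdot> \<one>\<close> is
  zero, so \<open>[p] \<cdot> \<one>\<close> is no unit of the field.\<close>

lemma char_p: "[p] \<cdot> \<one> = \<zero>"
proof -
  have "[(p ^ f)] \<cdot> \<one> = \<zero>"
    using add.pow_order_eq_1[of \<one>] card_carrier by (simp add: order_def)
  moreover have "[(p ^ k)] \<cdot> \<one> = ([p] \<cdot> \<one>) [^] k" for k
  proof (induction k)
    case (Suc k)
    have "[(p ^ Suc k)] \<cdot> \<one> = [p] \<cdot> ([(p ^ k)] \<cdot> \<one>)"
      by (simp add: add.nat_pow_pow mult.commute)
    also have "\<dots> = [(p ^ k)] \<cdot> \<one> \<otimes> [p] \<cdot> \<one>"
      by (simp add: add_pow_rdistr)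
    finally show ?case using Suc by simp
  qed simp
  ultimately have "([p] \<cdot> \<one>) [^] f = \<zero>" by simp
  then have "([p] \<cdot> \<one>) [^] f \<notin> Units R" using field_Units by simp
  then have "[p] \<cdot> \<one> \<notin> Units R" using Units_pow_closed by blast
  then show ?thesis using field_Units by auto
qed

lemma pow_p_add: "x \<in> carrier R \<Longrightarrow> y \<in> carrier R \<Longrightarrow> (x \<oplus> y) [^] p = x [^] p \<oplus> y [^] p"
  by (rule frobenius_add[OF prime_p char_p])

lemma pow_pow_p_add:
  assumes "x \<in> carrier R" "y \<in> carrier R"
  shows "(x \<oplus> y) [^] (p ^ j) = x [^] (p ^ j) \<oplus> y [^] (p ^ j)"
proof (induction j)
  case (Suc j)
  have "(x \<oplus> y) [^] (p ^ Suc j) = ((x \<oplus> y) [^] (p ^ j)) [^] p"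
    using assms by (simp add: nat_pow_pow mult.commute)
  also have "\<dots> = (x [^] (p ^ j)) [^] p \<oplus> (y [^] (p ^ j)) [^] p"
    using assms Suc by (simp add: pow_p_add)
  also have "\<dots> = x [^] (p ^ Suc j) \<oplus> y [^] (p ^ Suc j)"
    using assms by (simp add: nat_pow_pow mult.commute)
  finally show ?case .
qed (use assms in simp)

lemma pow_card: 
  assumes "x \<in> carrier R"
  shows "x [^] (p ^ f) = x"
proof (cases "x = \<zero>")
  case True
  then show ?thesis using p_gt_1 by (simp add: nat_pow_zero)
next
  case False
  interpret M: group "mult_of R" by (rule field_mult_group)
  have "x [^] (p ^ f - 1) = \<one>"
    using M.pow_order_eq_1[of x] assms False card_carrier order_mult_of[OF finite_carrier]
    by (simp add: order_def nat_pow_mult_of)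
  then have "x [^] Suc (p ^ f - 1) = x" using assms by simp
  then show ?thesis using p_gt_1 by simp
qed

lemma bij_betw_pow_p: "bij_betw (\<lambda>x. x [^] p) (carrier R) (carrier R)"
proof -
  have "inj_on (\<lambda>x. x [^] p) (carrier R)"
  \<comment> \<open>The \<open>f\<close>-fold iterate of the Frobenius map is the identity, so its
    iterate of order \<open>f - 1\<close> is an inverse.\<close>
  proof (rule inj_on_inverseI[where g = "\<lambda>x. x [^] (p ^ (f - 1))"])
    fix x assume x: "x \<in> carrier R"
    have "p * p ^ (f - 1) = p ^ f" using f_pos by (simp add: power_eq_if)
    then show "(x [^] p) [^] (p ^ (f - 1)) = x" using x pow_card by (simp add: nat_pow_pow)
  qed
  moreover have "(\<lambda>x. x [^] p) ` carrier R \<subseteq> carrier R" by auto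
  ultimately show ?thesis
    using endo_inj_surj[OF finite_carrier] by (auto simp: bij_betw_def)
qed

section \<open>The trace and its values in the prime field\<close>

abbreviation "Tr \<equiv> abs_trace R p f"

lemma abs_trace_closed: "x \<in> carrier R \<Longrightarrow> abs_trace R p n x \<in> carrier R"
  unfolding abs_trace_def by auto

lemma abs_trace_Suc:
  "x \<in> carrier R \<Longrightarrow> abs_trace R p (Suc n) x = x [^] (p ^ n) \<oplus> abs_trace R p n x"
  unfolding abs_trace_def lessThan_Suc by (subst finsum_insert) auto

lemma abs_trace_add:
  assumes "x \<in> carrier R" "y \<in> carrier R"
  shows "abs_trace R p n (x \<oplus> y) = abs_trace R p n x \<oplus> abs_trace R p n y"
  unfolding abs_trace_def using assms
  by (subst finsum_addf[symmetric]) (auto simp: pow_pow_p_add Pi_def cong: finsum_cong)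

text \<open>Frobenius shifts the summands by one place, so only the two boundary terms differ; they
  stand on opposite sides to avoid subtraction. For \<open>n = f\<close> they agree, which gives
  invariance of the trace.\<close>

lemma abs_trace_pow_p:
  assumes "x \<in> carrier R"
  shows "abs_trace R p n (x [^] p) \<oplus> x = abs_trace R p n x \<oplus> x [^] (p ^ n)"
proof (induction n)
  case 0
  show ?case using assms by (simp add: abs_trace_def)
next
  case (Suc n)
  have "abs_trace R p (Suc n) (x [^] p) \<oplus> x =
    (x [^] p) [^] (p ^ n) \<oplus> (abs_trace R p n (x [^] p) \<oplus> x)"
    using assms by (simp add: abs_trace_Suc abs_trace_closed a_assoc)
  also have "\<dots> = (x [^] p) [^] (p ^ n) \<oplus> (abs_trace R p n x \<oplus> x [^] (p ^ n))"
    using Suc by simp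
  also have "\<dots> = abs_trace R p (Suc n) x \<oplus> x [^] (p ^ Suc n)"
    using assms by (simp add: abs_trace_Suc abs_trace_closed a_ac nat_pow_pow)
  finally show ?case .
qed

lemma Tr_pow_p: "x \<in> carrier R \<Longrightarrow> Tr (x [^] p) = Tr x"
  using abs_trace_pow_p[of x f] by (simp add: pow_card abs_trace_closed)

lemma pow_p_abs_trace:
  assumes "x \<in> carrier R"
  shows "abs_trace R p n x [^] p = abs_trace R p n (x [^] p)"
proof (induction n)
  case 0
  show ?case using p_gt_1 by (simp add: abs_trace_def nat_pow_zero)
next
  case (Suc n)
  then show ?case
    using assms by (simp add: abs_trace_Suc abs_trace_closed pow_p_add nat_pow_pow mult.commute)
qed

lemma Tr_in_prime_field: "x \<in> carrier R \<Longrightarrow> Tr x [^] p = Tr x"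
  by (simp add: pow_p_abs_trace Tr_pow_p)

lemma nat_mult_one_pow_p: "([k] \<cdot> \<one>) [^] p = [(k::nat)] \<cdot> \<one>"
proof (induction k)
  case 0
  show ?case using p_gt_1 by (simp add: nat_pow_zero)
next
  case (Suc k)
  then show ?case by (simp add: pow_p_add)
qed

text \<open>The additive order of \<open>\<one>\<close> divides the prime \<open>p\<close> and is
  not 1.\<close>

lemma nat_mult_one_eq_0_iff: "[(k::nat)] \<cdot> \<one> = \<zero> \<longleftrightarrow> p dvd k"
proof -
  have "add.ord \<one> dvd p" using add.pow_eq_id[of \<one> p] char_p by simp
  then have "add.ord \<one> = 1 \<or> add.ord \<one> = p" using prime_p by (auto simp: prime_nat_iff)
  moreover have "add.ord \<one> \<noteq> 1" using add.ord_eq_1[of \<one>] by simp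
  ultimately show ?thesis using add.pow_eq_id[of \<one> k] by simp
qed

lemma nat_mult_one_eq_iff: "[(j::nat)] \<cdot> \<one> = [(k::nat)] \<cdot> \<one> \<longleftrightarrow> [j = k] (mod p)"
proof (induction j k rule: linorder_wlog)
  case (le j k)
  then obtain d where d: "k = j + d" using le_Suc_ex by blast
  have "[k] \<cdot> \<one> = [j] \<cdot> \<one> \<oplus> [d] \<cdot> \<one>" by (simp add: d add.nat_pow_mult)
  then have "[j] \<cdot> \<one> = [k] \<cdot> \<one> \<longleftrightarrow> [d] \<cdot> \<one> = \<zero>"
    by (metis add.nat_pow_closed one_closed a_comm add.r_cancel_one' add.l_cancel_one' )
  also have "\<dots> \<longleftrightarrow> p dvd d" by (rule nat_mult_one_eq_0_iff)
  also have "\<dots> \<longleftrightarrow> [j = k] (mod p)"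
    using d by (metis cong_altdef_nat cong_sym_eq diff_add_inverse le)
  finally show ?case .
next
  case (sym j k)
  then show ?case by (metis cong_sym_eq)
qed

text \<open>The multiples of \<open>\<one>\<close> by \<open>1, ..., p - 1\<close> are
  \<open>p - 1\<close> distinct solutions of \<open>x [^] (p - 1) = \<one>\<close>, which has at
  most that many.\<close>

lemma prime_field_eq:
  assumes "t \<in> carrier R" "t [^] p = t"
  shows "\<exists>k<p. [k] \<cdot> \<one> = t"
proof (cases "t = \<zero>")
  case True
  then show ?thesis using p_gt_1 by (intro exI[of _ 0]) auto
next
  case False
  let ?A = "(\<lambda>k::nat. [k] \<cdot> \<one>) ` {1..<p}" and ?B = "{x \<in> carrier R. x [^] (p - 1) = \<one>}"
  have p1: "p = Suc (p - 1)" using p_gt_1 by simp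
  have pow: "x [^] (p - 1) = \<one>" if "x \<in> carrier R" "x \<noteq> \<zero>" "x [^] p = x" for x
  proof -
    have "x [^] (p - 1) \<otimes> x = \<one> \<otimes> x"
      using that nat_pow_Suc[of x "p - 1"] p1 by simp
    then show ?thesis using that m_rcancel[of x "x [^] (p - 1)" \<one>] by simp
  qed
  have "inj_on (\<lambda>k::nat. [k] \<cdot> \<one>) {1..<p}"
    by (auto simp: inj_on_def nat_mult_one_eq_iff cong_def)
  then have "card ?A = p - 1" by (simp add: card_image)
  moreover have "?A \<subseteq> ?B"
  proof (rule image_subsetI)
    fix k assume k: "k \<in> {1..<p}"
    then have "\<not> p dvd k" by (auto dest: dvd_imp_le)
    then show "[k] \<cdot> \<one> \<in> ?B"
      using pow[of "[k] \<cdot> \<one>"] by (simp add: nat_mult_one_pow_p nat_mult_one_eq_0_iff)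
  qed
  moreover have "card ?B \<le> p - 1"
    using num_roots_le_deg[OF finite_carrier, of "p - 1"] p_gt_1 by simp
  ultimately have "?A = ?B"
    using finite_carrier by (intro card_seteq) auto
  moreover have "t \<in> ?B" using pow assms False by simp
  ultimately obtain k where "k \<in> {1..<p}" "t = [k] \<cdot> \<one>" by blast
  then show ?thesis by auto
qed

text \<open>This justifies the definite description in the definition of
  \<open>trace_residue\<close>.\<close>

lemma trace_residue:
  assumes "x \<in> carrier R"
  shows "trace_residue R p f x < p" "[(trace_residue R p f x)] \<cdot> \<one> = Tr x"
proof -
  obtain k where k: "k < p" "[k] \<cdot> \<one> = Tr x"
    using prime_field_eq[of "Tr x"] assms Tr_in_prime_field abs_trace_closed by auto
  have "\<exists>!k. k < p \<and> [k] \<cdot> \<one> = Tr x"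
    using k by (intro ex1I[of _ k]) (auto simp: nat_mult_one_eq_iff cong_def simp flip: k(2))
  from theI'[OF this] show "trace_residue R p f x < p" "[(trace_residue R p f x)] \<cdot> \<one> = Tr x"
    by (auto simp: trace_residue_def)
qed

text \<open>The trace is a polynomial function of degree \<open>p ^ (f - 1)\<close>, so it has fewer
  than \<open>p ^ f\<close> zeros.\<close>

lemma exists_Tr_nonzero: "\<exists>x\<in>carrier R. Tr x \<noteq> \<zero>"
proof (rule ccontr)
  assume neg: "\<not> ?thesis"
  interpret U: UP_domain R "UP R" by unfold_locales
  \<comment> \<open>The index is shifted: \<open>n\<close> stands for \<open>Suc n\<close> summands,
    so that the induction starts at the monomial of degree 1 instead of the zero polynomial.\<close>
  have "\<exists>P\<in>carrier (UP R). deg R P = p ^ n \<and>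
    (\<forall>x\<in>carrier R. eval R R id x P = abs_trace R p (Suc n) x)" for n
  proof (induction n)
    case 0
    show ?case
    proof (intro bexI conjI ballI)
      fix x assume "x \<in> carrier R"
      then show "eval R R id x (monom (UP R) \<one> 1) = abs_trace R p (Suc 0) x"
        using U.evalRR_monom[of \<one> x 1] by (simp add: abs_trace_def lessThan_Suc del: id_def)
    qed simp_all
  next
    case (Suc n)
    then obtain P where P: "P \<in> carrier (UP R)" "deg R P = p ^ n"
      "\<And>x. x \<in> carrier R \<Longrightarrow> eval R R id x P = abs_trace R p (Suc n) x" by blast
    show ?case
    proof (rule bexI[of _ "monom (UP R) \<one> (p ^ Suc n) \<oplus>\<^bsub>UP R\<^esub> P"])
      have "p ^ n < p ^ Suc n" using p_gt_1 by simp
      then have "deg R (monom (UP R) \<one> (p ^ Suc n) \<oplus>\<^bsub>UP R\<^esub> P) = p ^ Suc n"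
        using P by (subst U.deg_add_eq) auto
      then show "deg R (monom (UP R) \<one> (p ^ Suc n) \<oplus>\<^bsub>UP R\<^esub> P) = p ^ Suc n \<and>
        (\<forall>x\<in>carrier R. eval R R id x (monom (UP R) \<one> (p ^ Suc n) \<oplus>\<^bsub>UP R\<^esub> P) =
          abs_trace R p (Suc (Suc n)) x)"
        using P by (simp add: U.evalRR_simps abs_trace_Suc[of _ "Suc n"])
    qed (use P in auto)
  qed
  from this[of "f - 1", unfolded Suc_diff_1[OF f_pos]] obtain P where P: "P \<in> carrier (UP R)" "deg R P = p ^ (f - 1)"
    "\<And>x. x \<in> carrier R \<Longrightarrow> eval R R id x P = Tr x" by blast
  have "P \<noteq> \<zero>\<^bsub>UP R\<^esub>" using P(2) p_gt_1 U.deg_nzero_nzero[of P] by simp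
  then have "card {x \<in> carrier R. eval R R id x P = \<zero>} \<le> p ^ (f - 1)"
    using U.roots_bound[OF P(1)] finite_carrier P(2) by simp
  moreover have "{x \<in> carrier R. eval R R id x P = \<zero>} = carrier R" using neg P(3) by auto
  moreover have "p ^ (f - 1) < p ^ f" using p_gt_1 f_pos by simp
  ultimately show False using card_carrier by simp
qed

section \<open>Powers of \<open>zeta p\<close> and the additive character of the field\<close>

lemma zeta_eq_cis: "zeta k = cis (2 * pi / real k)"
  by (simp add: zeta_def cis_conv_exp mult_ac)

lemma zeta_power_p: "zeta p ^ p = 1"
  using p_gt_1 by (simp add: zeta_eq_cis DeMoivre)

lemma zeta_power_neq_1:
  assumes "0 < k" "k < p" shows "zeta p ^ k \<noteq> 1"
proof
  assume "zeta p ^ k = 1"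
  then have "cos (real k * (2 * pi / real p)) = 1"
    by (simp add: zeta_eq_cis DeMoivre complex_eq_iff)
  then obtain n :: int where n: "real k * (2 * pi / real p) = real_of_int n * 2 * pi"
    using cos_one_2pi_int by auto
  then have "real k = real_of_int n * real p" using p_gt_1 by (simp add: field_simps)
  then have "int k = n * int p" by (metis of_int_eq_iff of_int_mult of_int_of_nat_eq)
  then have "int p dvd int k" by simp
  then have "p dvd k" by (simp only: int_dvd_int_iff)
  then show False using assms dvd_imp_le by fastforce
qed

lemma zeta_power_cong:
  assumes "[j = k] (mod p)" shows "zeta p ^ j = zeta p ^ k"
proof -
  have "zeta p ^ j = zeta p ^ (j mod p)" for j
    using div_mult_mod_eq[of j p] zeta_power_p
    by (metis mult.commute mult_1 power_add power_mult power_one)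
  then show ?thesis using assms by (metis cong_def)
qed

end

sublocale prime_power_field \<subseteq> finite_field_additive_char R "\<lambda>x. zeta p ^ trace_residue R p f x"
proof
  fix x y assume xy: "x \<in> carrier R" "y \<in> carrier R"
  \<comment> \<open>Multiples of \<open>\<one>\<close> determine the factor modulo \<open>p\<close>,
    so additivity of the trace passes to its residues as a congruence.\<close>
  have "[trace_residue R p f (x \<oplus> y) = trace_residue R p f x + trace_residue R p f y] (mod p)"
    using xy trace_residue(2) abs_trace_add[of x y f]
    by (simp flip: nat_mult_one_eq_iff add: trace_residue(2) flip: add.nat_pow_mult)
  from zeta_power_cong[OF this]
  show "zeta p ^ trace_residue R p f (x \<oplus> y) =
    zeta p ^ trace_residue R p f x * zeta p ^ trace_residue R p f y"
    by (simp add: power_add)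
next
  have "Tr \<zero> = \<zero>" using abs_trace_add[of \<zero> \<zero> f] abs_trace_closed[of \<zero> f] by simp
  then have "p dvd trace_residue R p f \<zero>"
    using trace_residue(2)[of \<zero>] by (simp add: nat_mult_one_eq_0_iff)
  then have "[trace_residue R p f \<zero> = 0] (mod p)" by (simp add: cong_0_iff)
  from zeta_power_cong[OF this] show "zeta p ^ trace_residue R p f \<zero> = 1" by simp
next
  obtain x where x: "x \<in> carrier R" "Tr x \<noteq> \<zero>" using exists_Tr_nonzero by auto
  then have "trace_residue R p f x \<noteq> 0"
    using trace_residue(2)[of x] by (intro notI) simp
  then have "zeta p ^ trace_residue R p f x \<noteq> 1"
    using trace_residue(1)[of x] x by (intro zeta_power_neq_1) auto
  then show "\<exists>a\<in>carrier R. zeta p ^ trace_residue R p f a \<noteq> 1" using x by auto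
qed (rule finite_carrier)

section \<open>Pure Gauss sums\<close>

context prime_power_field
begin

lemma Gauss_sum_eq_gauss: "Gauss_sum R p f \<eta> = gauss (\<lambda>x. if x = \<zero> then 0 else \<eta> x)"
  unfolding Gauss_sum_def gauss_def sum_carrier_remove_zero[of "\<lambda>x. (if x = \<zero> then 0 else \<eta> x) * _ x"]
  by (auto intro!: sum.cong)

text \<open>The Frobenius map permutes the field and preserves the trace, so it serves as a
  substitution in the sum.\<close>

lemma gauss_pow_p:
  assumes "ext_char \<chi>"
  shows "gauss (\<lambda>x. \<chi> x ^ p) = gauss \<chi>"
proof -
  have "\<chi> x ^ p * zeta p ^ trace_residue R p f x =
    \<chi> (x [^] p) * zeta p ^ trace_residue R p f (x [^] p)" if "x \<in> carrier R" for x
  proof -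
    have "trace_residue R p f (x [^] p) = trace_residue R p f x"
      using that by (simp add: trace_residue_def Tr_pow_p)
    moreover have "\<chi> (x [^] n) = \<chi> x ^ n" for n :: nat
      using that assms by (induction n) (simp_all add: ext_charD)
    ultimately show ?thesis by simp
  qed
  then have "gauss (\<lambda>x. \<chi> x ^ p) =
    (\<Sum>x\<in>carrier R. \<chi> (x [^] p) * zeta p ^ trace_residue R p f (x [^] p))"
    unfolding gauss_def by (intro sum.cong) auto
  also have "\<dots> = gauss \<chi>"
    unfolding gauss_def
    by (rule sum.reindex_bij_betw[OF bij_betw_pow_p, of "\<lambda>x. \<chi> x * zeta p ^ trace_residue R p f x"])
  finally show ?thesis .
qed

lemma gauss_pow_p_power:
  assumes "ext_char \<chi>"
  shows "gauss (\<lambda>x. \<chi> x ^ (p ^ k)) = gauss \<chi>"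
proof (induction k)
  case (Suc k)
  have "ext_char (\<lambda>x. \<chi> x ^ (p ^ k))" using assms p_gt_1 by (intro ext_char_power) auto
  from gauss_pow_p[OF this] Suc show ?case by (simp add: mult.commute flip: power_mult)
qed simp

text \<open>Here \<open>\<eta>\<close> is its own inverse, so \<open>gauss_mult_inverse\<close>
  yields the square of the Gauss sum up to the sign \<open>\<eta> (\<ominus> \<one>)\<close>. The
  fourth power removes that sign.\<close>

lemma gauss_quadratic_power4:
  assumes \<eta>: "ext_char \<eta>"
    and quad: "\<And>x. x \<in> carrier R \<Longrightarrow> x \<noteq> \<zero> \<Longrightarrow> \<eta> x ^ 2 = 1"
    and a: "a \<in> carrier R" "a \<noteq> \<zero>" "\<eta> a \<noteq> 1"
  shows "gauss \<eta> ^ 4 = of_nat (p ^ f) ^ 2"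
proof -
  have "inverse (\<eta> x) = \<eta> x" if "x \<in> carrier R" for x
    using quad[OF that] ext_charD(1)[OF \<eta>]
    by (cases "x = \<zero>") (auto intro: inverse_unique simp: power2_eq_square)
  then have "gauss (\<lambda>x. inverse (\<eta> x)) = gauss \<eta>"
    unfolding gauss_def by (intro sum.cong) auto
  then have sq: "gauss \<eta> ^ 2 = \<eta> (\<ominus> \<one>) * of_nat (p ^ f)"
    using gauss_mult_inverse[OF \<eta> a] card_carrier by (simp add: power2_eq_square)
  have "gauss \<eta> ^ 4 = (gauss \<eta> ^ 2) ^ 2" by (simp flip: power_mult)
  also have "\<dots> = (\<eta> (\<ominus> \<one>) * \<eta> (\<ominus> \<one>)) * of_nat (p ^ f) ^ 2"
    unfolding sq by (simp add: power2_eq_square mult_ac)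
  finally show ?thesis using ext_char_minus_one_square[OF \<eta>] by simp
qed

lemma two_nonzero: "odd p \<Longrightarrow> \<one> \<oplus> \<one> \<noteq> \<zero>"
  using nat_mult_one_eq_0_iff[of 2] primes_dvd_imp_eq[OF prime_p two_is_prime_nat]
  by (auto simp: numeral_2_eq_2)

text \<open>The hypotheses \<open>order\<close> and \<open>minimal\<close> together say that
  \<open>\<theta>\<close> has exact order \<open>2 * M\<close>. The exponent \<open>4 * M\<close>
  absorbs both the sign of the squared quadratic Gauss sum and the root of unity
  \<open>\<chi>(4)\<close>.\<close>

theorem gauss_power:
  assumes p: "odd p" and M: "odd M" and k: "[p ^ k = 2] (mod M)"
    and \<theta>: "ext_char \<theta>"
    and order: "\<And>x. x \<in> carrier R \<Longrightarrow> x \<noteq> \<zero> \<Longrightarrow> \<theta> x ^ (2 * M) = 1"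
    and minimal: "\<And>n. 0 < n \<Longrightarrow> n < 2 * M \<Longrightarrow> \<exists>x\<in>carrier R. x \<noteq> \<zero> \<and> \<theta> x ^ n \<noteq> 1"
  shows "gauss \<theta> ^ (4 * M) = of_nat (p ^ f) ^ (2 * M)"
proof -
  have M0: "0 < M" using M by (rule odd_pos)
  define \<eta> where "\<eta> = (\<lambda>x. \<theta> x ^ M)"
  have \<eta>: "ext_char \<eta>" unfolding \<eta>_def using \<theta> M0 by (rule ext_char_power)
  have quad: "\<eta> x ^ 2 = 1" if "x \<in> carrier R" "x \<noteq> \<zero>" for x
    using order[OF that] by (simp add: \<eta>_def mult.commute flip: power_mult)
  obtain a where a: "a \<in> carrier R" "a \<noteq> \<zero>" "\<eta> a \<noteq> 1"
    using minimal[of M] M0 by (auto simp: \<eta>_def)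
  have "(gauss \<eta> ^ 4) ^ M = (of_nat (p ^ f) ^ 2) ^ M"
    using gauss_quadratic_power4[OF \<eta> quad a] by simp
  then have g\<eta>: "gauss \<eta> ^ (4 * M) = of_nat (p ^ f) ^ (2 * M)"
    by (simp only: power_mult)
  show ?thesis
  \<comment> \<open>For \<open>M = 1\<close> the character \<open>\<theta>\<close> is
    \<open>\<eta>\<close> itself, and \<open>\<chi>\<close> would be trivial, so duplication does
    not apply.\<close>
  proof (cases "M = 1")
    case True
    then show ?thesis using g\<eta> by (simp add: \<eta>_def)
  next
    case False
    then have M1: "1 < M" using M0 by simp
    define \<chi> where "\<chi> = (\<lambda>x. \<theta> x ^ (M + 1))"
    have \<chi>: "ext_char \<chi>" unfolding \<chi>_def using \<theta> by (rule ext_char_power) simp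
    have \<chi>M: "\<chi> x ^ M = 1" if "x \<in> carrier R" "x \<noteq> \<zero>" for x
    proof -
      \<comment> \<open>As \<open>M\<close> is odd, \<open>(M + 1) * M\<close> is a multiple of
        \<open>2 * M\<close>.\<close>
      obtain c where "M + 1 = 2 * c" using M by (metis evenE odd_even_add odd_one)
      then have "(M + 1) * M = 2 * M * c" by simp
      then have "\<chi> x ^ M = (\<theta> x ^ (2 * M)) ^ c" by (simp only: \<chi>_def flip: power_mult)
      then show ?thesis using order[OF that] by simp
    qed
    have \<eta>\<chi>: "\<eta> x * \<chi> x = \<theta> x" if "x \<in> carrier R" for x
    proof (cases "x = \<zero>")
      case True
      then show ?thesis using \<eta> \<theta> by (simp add: ext_charD(1))
    next
      case False
      have "\<eta> x * \<chi> x = \<theta> x ^ (M + (M + 1))" by (simp only: \<eta>_def \<chi>_def power_add)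
      also have "M + (M + 1) = 2 * M + 1" by simp
      also have "\<theta> x ^ \<dots> = \<theta> x" using order[OF that False] by simp
      finally show ?thesis .
    qed
    have \<chi>2: "\<chi> x ^ 2 = \<theta> x ^ 2" if "x \<in> carrier R" "x \<noteq> \<zero>" for x
    proof -
      have "(M + 1) * 2 = 2 * M + 2" by simp
      then have "\<chi> x ^ 2 = \<theta> x ^ (2 * M + 2)" by (simp only: \<chi>_def flip: power_mult)
      then show ?thesis using order[OF that] by (simp only: power_add) simp
    qed
    \<comment> \<open>Off zero the squares of \<open>\<chi>\<close> and \<open>\<theta>\<close>
      agree, and 2 lies below the order \<open>2 * M\<close> because \<open>M > 1\<close>.\<close>
    obtain b where b: "b \<in> carrier R" "b \<noteq> \<zero>" "\<chi> b ^ 2 \<noteq> 1"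
      using minimal[of 2] M1 \<chi>2 by auto
    have \<chi>p: "\<chi> x ^ (p ^ k) = \<chi> x ^ 2" if "x \<in> carrier R" for x
    proof (cases "x = \<zero>")
      case True
      then show ?thesis using \<chi> p_gt_1 by (simp add: ext_charD(1))
    next
      case False
      have "\<chi> x ^ n = \<chi> x ^ (n mod M)" for n
        using div_mult_mod_eq[of n M] \<chi>M[OF that False]
        by (metis mult.commute mult_1 power_add power_mult power_one)
      then show ?thesis using k by (metis cong_def)
    qed
    have "gauss (\<lambda>x. \<chi> x ^ 2) = gauss (\<lambda>x. \<chi> x ^ (p ^ k))"
      unfolding gauss_def using \<chi>p by (intro sum.cong) auto
    also have "\<dots> = gauss \<chi>" by (rule gauss_pow_p_power[OF \<chi>])
    finally have g\<chi>: "gauss (\<lambda>x. \<chi> x ^ 2) = gauss \<chi>" .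
    have g\<theta>: "gauss (\<lambda>x. \<eta> x * \<chi> x) = gauss \<theta>"
      unfolding gauss_def using \<eta>\<chi> by (intro sum.cong) auto
    have "\<chi> (\<one> \<oplus> \<one>) ^ 2 * (gauss \<chi> * gauss (\<lambda>x. \<eta> x * \<chi> x)) =
      gauss (\<lambda>x. \<chi> x ^ 2) * gauss \<eta>"
      by (rule gauss_duplication[OF two_nonzero[OF p] \<eta> quad a \<chi> b])
    then have "\<chi> (\<one> \<oplus> \<one>) ^ 2 * (gauss \<chi> * gauss \<theta>) = gauss \<chi> * gauss \<eta>"
      by (simp only: g\<chi> g\<theta>)
    moreover have "gauss \<chi> \<noteq> 0"
      using b by (intro gauss_nonzero[OF \<chi> b(1,2)]) auto
    ultimately have "gauss \<eta> = \<chi> (\<one> \<oplus> \<one>) ^ 2 * gauss \<theta>" by (simp add: mult.left_commute)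
    \<comment> \<open>The factor from \<open>\<chi>\<close> has total exponent \<open>8 * M\<close>,
      regrouped to expose the \<open>M\<close>-th power, which is 1.\<close>
    then have "gauss \<eta> ^ (4 * M) = (\<chi> (\<one> \<oplus> \<one>) ^ M) ^ 8 * gauss \<theta> ^ (4 * M)"
      by (simp add: power_mult_distrib mult_ac flip: power_mult)
    then show ?thesis using g\<eta> \<chi>M[of "\<one> \<oplus> \<one>"] two_nonzero[OF p] by simp
  qed
qed

end

section \<open>Purity of triples, and powers with integer exponent\<close>

theorem pure_triplesI:
  assumes p: "prime p" "odd p" and f: "0 < f" and M: "odd M" and dvd: "2 * M dvd p ^ f - 1"
    and k: "[p ^ k = 2] (mod M)"
  shows "(2 * M, f, p) \<in> pure_triples"
proof -
  have "pure_Gauss_sum F p f \<eta>"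
    if F: "field F" "finite (carrier F)" "card (carrier F) = p ^ f"
      and \<eta>: "mult_char F \<eta>" and ord: "char_order F \<eta> = 2 * M" for F :: "nat ring" and \<eta>
  proof -
    interpret prime_power_field F p f
      using F p f by (simp add: prime_power_field_def prime_power_field_axioms_def)
    have hom: "\<eta> x \<noteq> 0" "\<eta> (x \<otimes>\<^bsub>F\<^esub> y) = \<eta> x * \<eta> y"
      if "x \<in> carrier F - {\<zero>\<^bsub>F\<^esub>}" "y \<in> carrier F - {\<zero>\<^bsub>F\<^esub>}" for x y
      using \<eta> that by (auto simp: mult_char_def hom_def complex_mult_def Pi_def)
    have one: "\<eta> \<one>\<^bsub>F\<^esub> = 1" using hom[of "\<one>\<^bsub>F\<^esub>" "\<one>\<^bsub>F\<^esub>"] by simp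
    define \<theta> where "\<theta> = (\<lambda>x. if x = \<zero>\<^bsub>F\<^esub> then 0 else \<eta> x)"
    have \<theta>: "ext_char \<theta>"
      using hom one by (auto simp: ext_char_def \<theta>_def integral_iff)
    let ?P = "\<lambda>k. 0 < k \<and> (\<forall>x\<in>carrier (mult_of F). \<eta> x ^ k = 1)"
    \<comment> \<open>The \<open>LEAST\<close> in \<open>char_order\<close> is meaningful only once
      some exponent qualifies; the order of the multiplicative group does.\<close>
    have "?P (p ^ f - 1)"
    proof (intro conjI ballI)
      show "0 < p ^ f - 1" using one_less_power[OF p_gt_1 f] by simp
      fix x assume x: "x \<in> carrier (mult_of F)"
      have "\<theta> (x [^]\<^bsub>F\<^esub> n) = \<theta> x ^ n" for n :: nat
        using x \<theta> by (induction n) (simp_all add: ext_charD)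
      from this[of "p ^ f"] have "\<theta> x ^ Suc (p ^ f - 1) = \<theta> x"
        using x pow_card[of x] p_gt_1 by simp
      then show "\<eta> x ^ (p ^ f - 1) = 1" using x hom(1)[of x x] by (simp add: \<theta>_def)
    qed
    then have least: "?P (2 * M)"
      unfolding ord[symmetric] char_order_def by (rule LeastI)
    have minimal: "\<not> ?P n" if "n < 2 * M" for n
      using that unfolding ord[symmetric] char_order_def by (rule not_less_Least)
    have "gauss \<theta> ^ (4 * M) = of_nat (p ^ f) ^ (2 * M)"
    proof (rule gauss_power[OF p(2) M k \<theta>])
      show "\<theta> x ^ (2 * M) = 1" if "x \<in> carrier F" "x \<noteq> \<zero>\<^bsub>F\<^esub>" for x
        using least that by (simp add: \<theta>_def)
      show "\<exists>x\<in>carrier F. x \<noteq> \<zero>\<^bsub>F\<^esub> \<and> \<theta> x ^ n \<noteq> 1" if "0 < n" "n < 2 * M" for n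
        using minimal[OF that(2)] that(1) by (auto simp: \<theta>_def)
    qed
    \<comment> \<open>The square of the normalising factor is the inverse of \<open>p ^ f\<close>,
      so the even exponent clears the half power.\<close>
    moreover have "(real p powr (- real f / 2)) ^ (4 * M) * real (p ^ f) ^ (2 * M) = 1"
    proof -
      have "(real p powr (- real f / 2)) ^ 2 = real p powr (- real f)"
        using p_gt_1 by (simp add: powr_power)
      also have "\<dots> = inverse (real (p ^ f))"
        using p_gt_1 by (simp add: powr_minus powr_realpow)
      finally have "((real p powr (- real f / 2)) ^ 2) ^ (2 * M) = inverse (real (p ^ f)) ^ (2 * M)"
        by simp
      then have "(real p powr (- real f / 2)) ^ (4 * M) = inverse (real (p ^ f)) ^ (2 * M)"
        by (simp flip: power_mult)
      then show ?thesis using p_gt_1 by (simp flip: power_mult_distrib)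
    qed
    then have "complex_of_real ((real p powr (- real f / 2)) ^ (4 * M) * real (p ^ f) ^ (2 * M)) = 1"
      by simp
    ultimately have "(of_real (real p powr (- real f / 2)) * gauss \<theta>) ^ (4 * M) = 1"
      by (simp add: power_mult_distrib)
    moreover have "Gauss_sum F p f \<eta> = gauss \<theta>"
      by (simp add: Gauss_sum_eq_gauss \<theta>_def)
    moreover have "0 < 4 * M" using M by (simp add: odd_pos)
    ultimately show ?thesis unfolding pure_Gauss_sum_def root_of_unity_def by metis
  qed
  then show ?thesis using p f dvd by (simp add: pure_triples_def)
qed

text \<open>Modulo \<open>M\<close> the inverse of \<open>p\<close> is \<open>p ^ (f - 1)\<close>,
  so negative exponents can be traded for natural ones.\<close>

lemma mod_powi_eq_power:
  fixes p M f :: nat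
  assumes f: "0 < f" and pf: "[p ^ f = 1] (mod M)"
  shows "\<exists>k. [mod_powi (int M) (int p) i = int (p ^ k)] (mod int M)"
proof (cases "0 \<le> i")
  case True
  then show ?thesis by (auto simp: mod_powi_def intro!: exI[of _ "nat i"])
next
  case False
  let ?n = "nat (- i)" and ?w = "modular_inverse (int M) (int p)"
  have pf': "[int p ^ f = 1] (mod int M)"
    using pf cong_int_iff[of "p ^ f" 1 M] by simp
  then have "coprime (int p) (int M)"
    using f cong_imp_coprime[OF cong_sym[OF pf']] by simp
  then have inv: "[int p * ?w = 1] (mod int M)" by (rule cong_modular_inverse1)
  \<comment> \<open>The power of \<open>?w\<close> is multiplied by \<open>(int p ^ f) ^ ?n\<close>,
    congruent to 1; \<open>?n\<close> of the factors \<open>p\<close> cancel against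
    \<open>?w ^ ?n\<close> and \<open>(f - 1) * ?n\<close> remain.\<close>
  have "f * ?n = (f - 1) * ?n + ?n" using f by (simp add: diff_mult_distrib)
  then have split: "(int p ^ f) ^ ?n = int p ^ ((f - 1) * ?n) * int p ^ ?n"
    by (simp add: power_add flip: power_mult)
  have "[?w ^ ?n * (int p ^ f) ^ ?n = ?w ^ ?n * 1 ^ ?n] (mod int M)"
    by (intro cong_mult cong_pow pf' cong_refl)
  then have 1: "[?w ^ ?n = ?w ^ ?n * (int p ^ f) ^ ?n] (mod int M)" by (simp add: cong_sym)
  have "?w ^ ?n * (int p ^ f) ^ ?n = (int p * ?w) ^ ?n * int p ^ ((f - 1) * ?n)"
    unfolding split by (simp add: power_mult_distrib mult_ac)
  also have "[\<dots> = 1 ^ ?n * int p ^ ((f - 1) * ?n)] (mod int M)"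
    by (intro cong_mult cong_pow inv cong_refl)
  finally have "[?w ^ ?n = int p ^ ((f - 1) * ?n)] (mod int M)"
    using 1 cong_trans by fastforce
  then show ?thesis using False by (auto simp: mod_powi_def intro!: exI[of _ "(f - 1) * ?n"])
qed

theorem theorem4p5:
  fixes p N f r :: nat and q u m :: "nat \<Rightarrow> nat"
  assumes "prime p"
    and "inj_on q {1..r}"
    and "\<And>i. i \<in> {1..r} \<Longrightarrow> prime (q i) \<and> odd (q i)"
    and "\<And>i. i \<in> {1..r} \<Longrightarrow> u i \<ge> 1"
    and "\<And>i. i \<in> {1..r} \<Longrightarrow> m i = q i ^ u i"
    and "N = 2 * (\<Prod>i\<in>{1..r}. m i)"
    and "f = ord N p"
    and "odd f"
    and "\<exists>i::int. [mod_powi (int (N div 2)) (int p) i = 2] (mod (int (N div 2)))"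
  shows "(N, f, p) \<in> pure_triples_star \<and> property_star m r f p"
proof -
  define M where "M = (\<Prod>i\<in>{1..r}. m i)"
  have N: "N = 2 * M" using assms(6) by (simp add: M_def)
  have f: "0 < f" using \<open>odd f\<close> by (rule odd_pos)
  \<comment> \<open>The value of \<open>ord\<close> is 0 when its arguments are not coprime, so a
    positive \<open>f\<close> forces coprimality. Since \<open>N\<close> is even, \<open>p\<close>
    is odd.\<close>
  then have "coprime N p" using assms(7) by (simp add: ord_eq_0)
  then have p: "odd p" unfolding N by simp
  have pf: "[p ^ f = 1] (mod N)" unfolding assms(7) using ord_works by blast
  then have N_dvd: "N dvd p ^ f - 1"
    by (rule cong_to_1_nat)
  have "[p ^ f = 1] (mod M)" using pf by (rule cong_dvd_modulus_nat) (simp add: N)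
  then obtain k where k: "[p ^ k = 2] (mod M)"
  proof -
    assume *: "[p ^ f = 1] (mod M)" and thesis: "\<And>k. [p ^ k = 2] (mod M) \<Longrightarrow> thesis"
    obtain i where "[mod_powi (int M) (int p) i = 2] (mod int M)" using assms(9) N by auto
    moreover obtain k where "[mod_powi (int M) (int p) i = int (p ^ k)] (mod int M)"
      using mod_powi_eq_power[OF f *] by blast
    ultimately have "[int (p ^ k) = int 2] (mod int M)"
      by (metis cong_sym cong_trans of_nat_numeral)
    then show thesis by (intro thesis) (simp only: cong_int_iff)
  qed
  \<comment> \<open>Each partial product divides \<open>M\<close>, so the congruence for 2 descends
    to it. The full index set gives \<open>N\<close> itself, the other sets give property
    \<open>property_star\<close>.\<close>
  have pure: "(2 * (\<Prod>i\<in>J. m i), f, p) \<in> pure_triples" if J: "J \<subseteq> {1..r}" for J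
  proof (rule pure_triplesI[OF assms(1) p f, of _ k])
    have MJ: "(\<Prod>i\<in>J. m i) dvd M" unfolding M_def using J by (intro prod_dvd_prod_subset) auto
    have "odd (m i)" if "i \<in> {1..r}" for i using assms(3,5)[OF that] by simp
    then show "odd (\<Prod>i\<in>J. m i)"
      using J finite_subset[OF J] by (auto simp: even_prod_iff)
    show "2 * (\<Prod>i\<in>J. m i) dvd p ^ f - 1"
      using MJ N N_dvd by (meson dvd_trans mult_dvd_mono dvd_refl)
    show "[p ^ k = 2] (mod (\<Prod>i\<in>J. m i))" using k MJ by (rule cong_dvd_modulus_nat)
  qed
  then show ?thesis
    using pure[of "{1..r}"] assms(6,7) by (auto simp: pure_triples_star_def property_star_def)
qed

end
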